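(* Let $\{(A_n,p_n)\}_{n\in\mathbb{N}}$ be a rare-events source with support interval $C$ and limit distribution $P$. Let $\tilde P_n$, $n\in\mathbb{N}$, be random probability measures on $\mathbb{R}^+$, where $\tilde P_n$ is constructed from the samples $X_{n,1},\dots,X_{n,n}$, such that for some $s>0$, $n^s d_{\mathrm W}(\tilde P_n,P)\to0$ almost surely. Let $D_n=n^{s/2}$ and $$\hat Y_n^A=\int_{\mathbb{R}^+}x_{D_n}^{-1}\,\mathrm{d}\tilde P_n(x),$$ where $x_{D}^{-1}$ denotes the $D$-tapered version of the function $x\mapsto 1/x$. Then $\hat Y_n^A$ is a consistent estimator of the normalized alphabet size $Y_n^A=|A_n|/n$: $\hat Y_n^A\to\int_C\frac1x\,\mathrm{d}P(x)$ almost surely, and $|A_n|/n\to\int_C\frac1x\,\mathrm{d}P(x)$, as $n\to\infty$.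
   Context: Rare-events source: a sequence $\{(A_n,p_n)\}_{n\in\mathbb{N}}$, where $A_n$ is a finite alphabet and $p_n$ a probability mass function on $A_n$, such that, with $X_n\sim p_n$, $Z_n=n\,p_n(X_n)$ and $P_n$ the distribution of $Z_n$: (i) there is an interval $C=[\check c,\hat c]$ with $0<\check c\le\hat c<\infty$ such that $\check c/n\le p_n(a)\le\hat c/n$ for all $n$ and all $a\in A_n$; (ii) there is a probability distribution $P$ with $P_n\Rightarrow P$ weakly (so $P$ is supported on $C$). Sampling: for each $n$, $X_{n,1},\dots,X_{n,n}$ are i.i.d. from $p_n$; all samples live on a common probability space. Tapered function: for a real-valued function $g$ on $(0,\infty)$ and $D\ge1$, the $D$-tapered version $g_D$ is defined on $\mathbb{R}^+=[0,\infty)$ by $g_D(x)=g(D^{-1})$ for $x<D^{-1}$, $g_D(x)=g(x)$ for $x\in[D^{-1},D]$, and $g_D(x)=g(D)$ for $x>D$. The Wasserstein distance between probability measures on $\mathbb{R}^+$ is $d_{\mathrm W}(Q_1,Q_2)=\int_{\mathbb{R}^+}|F(x;Q_1)-F(x;Q_2)|\,\mathrm{d}x$, where $F(\cdot;Q)$ is the cumulative distribution function of $Q$. *)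

theory Defs
  imports "HOL-Probability.Probability"
begin

text \<open>The distribution of \<open>Z = n q(X)\<close>, where \<open>X\<close> has probability mass function \<open>q\<close>.\<close>

definition scaled_prob_distr :: "nat \<Rightarrow> 'a pmf \<Rightarrow> real measure" where
  "scaled_prob_distr n q = distr (measure_pmf q) borel (\<lambda>a. real n * pmf q a)"

text \<open>Sequences are indexed by \<open>n \<ge> 1\<close>; the entry at \<open>n = 0\<close> is unconstrained. The bounds
  \<open>c1\<close> and \<open>c2\<close> are the end points of the support interval \<open>C\<close>.\<close>

definition rare_events_source ::
  "(nat \<Rightarrow> 'a set) \<Rightarrow> (nat \<Rightarrow> 'a pmf) \<Rightarrow> real \<Rightarrow> real \<Rightarrow> real measure \<Rightarrow> bool" where
  "rare_events_source A p c1 c2 P \<longleftrightarrow>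
     (\<forall>n\<ge>1. finite (A n) \<and> set_pmf (p n) \<subseteq> A n) \<and>
     0 < c1 \<and> c1 \<le> c2 \<and>
     (\<forall>n\<ge>1. \<forall>a\<in>A n. c1 / real n \<le> pmf (p n) a \<and> pmf (p n) a \<le> c2 / real n) \<and>
     real_distribution P \<and>
     weak_conv_m (\<lambda>n. scaled_prob_distr n (p n)) P"

text \<open>Independence is only required within each row \<open>X n 1, \<dots>, X n n\<close>; the joint law of different
  rows on the common probability space is arbitrary.\<close>

definition iid_samples ::
  "'w measure \<Rightarrow> (nat \<Rightarrow> 'a pmf) \<Rightarrow> (nat \<Rightarrow> nat \<Rightarrow> 'w \<Rightarrow> 'a) \<Rightarrow> bool" where
  "iid_samples M p X \<longleftrightarrow>
     prob_space M \<and>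
     (\<forall>n\<ge>1. prob_space.indep_vars M (\<lambda>_. count_space UNIV) (X n) {1..n} \<and>
       (\<forall>i\<in>{1..n}. distr M (count_space UNIV) (X n i) = measure_pmf (p n)))"

definition nonneg_distribution :: "real measure \<Rightarrow> bool" where
  "nonneg_distribution Q \<longleftrightarrow> real_distribution Q \<and> measure Q {0..} = 1"

text \<open>The random measures \<open>R n\<close> are built by a deterministic rule \<open>K n\<close> from the sample tuple. Since
  the alphabets are finite, every such rule is measurable. Outside the null event that some
  sample leaves its alphabet, \<open>R n\<close> is a probability measure on the nonnegative reals.\<close>

definition constructed_from_samples ::
  "'w measure \<Rightarrow> (nat \<Rightarrow> 'a set) \<Rightarrow> (nat \<Rightarrow> nat \<Rightarrow> 'w \<Rightarrow> 'a) \<Rightarrow> (nat \<Rightarrow> 'w \<Rightarrow> real measure) \<Rightarrow> bool" where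
  "constructed_from_samples M A X R \<longleftrightarrow>
     (\<exists>K :: nat \<Rightarrow> (nat \<Rightarrow> 'a) \<Rightarrow> real measure. \<forall>n\<ge>1.
        (\<forall>x \<in> {1..n} \<rightarrow>\<^sub>E A n. nonneg_distribution (K n x)) \<and>
        (\<forall>w\<in>space M. R n w = K n (\<lambda>i\<in>{1..n}. X n i w)))"

definition tapered :: "real \<Rightarrow> (real \<Rightarrow> real) \<Rightarrow> real \<Rightarrow> real" where
  "tapered D g x = (if x < inverse D then g (inverse D) else if x \<le> D then g x else g D)"

text \<open>The distance may be infinite, hence the extended nonnegative value.\<close>

definition wasserstein_dist :: "real measure \<Rightarrow> real measure \<Rightarrow> ennreal" where
  "wasserstein_dist Q1 Q2 = (\<integral>\<^sup>+x\<in>{0..}. ennreal \<bar>cdf Q1 x - cdf Q2 x\<bar> \<partial>lborel)"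

definition alphabet_size_estimator :: "real \<Rightarrow> nat \<Rightarrow> real measure \<Rightarrow> real" where
  "alphabet_size_estimator s n Q =
     (LINT x:{0..}|Q. tapered (real n powr (s / 2)) (\<lambda>y. 1 / y) x)"

definition normalized_alphabet_size :: "(nat \<Rightarrow> 'a set) \<Rightarrow> nat \<Rightarrow> real" where
  "normalized_alphabet_size A n = real (card (A n)) / real n"

end

theory Submission
  imports Defs "HOL-Real_Asymp.Real_Asymp"
begin

text \<open>The tapered reciprocal has the layer-cake form
  \<open>x\<^sub>D\<^sup>-\<^sup>1 = 1/D + \<integral> 1{x \<le> t} / t\<^sup>2 dt\<close> over \<open>t \<in> [1/D, D]\<close>.
  By Tonelli, its integral against a distribution is \<open>1/D\<close> plus the integral of the cumulative
  distribution function weighted by \<open>1/t\<^sup>2 \<le> D\<^sup>2\<close>, so replacing one distribution by another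
  changes it by at most \<open>D\<^sup>2\<close> times their Wasserstein distance; here \<open>D\<^sup>2 = n\<^sup>s\<close>. Once \<open>[1/D, D]\<close>
  contains \<open>C\<close>, the integral against \<open>P\<close> is the limit itself. For the deterministic part,
  \<open>|A\<^sub>n|/n\<close> is the expectation of \<open>1/Z\<^sub>n\<close>, and weak convergence applies to the bounded
  continuous function \<open>1/max(c1, x)\<close>.\<close>

section \<open>Layer-cake form of the tapered reciprocal\<close>

lemma borel_measurable_tapered_reciprocal [measurable]:
  "tapered D (\<lambda>y. 1 / y) \<in> borel_measurable borel"
  unfolding tapered_def[abs_def] by measurable

text \<open>Negative arguments fall into the first branch, with value \<open>D\<close>, so the
  bounds hold on the whole line. They make the function integrable under every probability
  distribution and let its integral be computed as a nonnegative one.\<close>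

lemma tapered_reciprocal_bounds:
  assumes "D \<ge> 1"
  shows "0 \<le> tapered D (\<lambda>y. 1 / y) x" "tapered D (\<lambda>y. 1 / y) x \<le> D"
proof -
  have D: "inverse D \<le> 1" "0 < inverse D"
    using assms by (auto simp: inverse_le_1_iff)
  show "0 \<le> tapered D (\<lambda>y. 1 / y) x"
  proof -
    have "0 \<le> x" if "inverse D \<le> x" using D(2) that by (rule less_imp_le[OF less_le_trans])
    then show ?thesis using assms by (simp add: tapered_def)
  qed
  have "1 / x \<le> D" if "inverse D \<le> x"
    using le_imp_inverse_le[OF that D(2)] by (simp add: inverse_eq_divide)
  then show "tapered D (\<lambda>y. 1 / y) x \<le> D"
    using assms order_trans[OF D(1) assms] by (auto simp: tapered_def inverse_eq_divide)
qed

lemma integrable_tapered_reciprocal: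
  assumes "real_distribution Q" "D \<ge> 1"
  shows "integrable Q (tapered D (\<lambda>y. 1 / y))"
proof -
  interpret real_distribution Q by fact
  show ?thesis
    using tapered_reciprocal_bounds[OF assms(2)]
    by (intro integrable_const_bound[where B = D]) auto
qed

text \<open>Since \<open>-1/t\<close> is an antiderivative of \<open>1/t^2\<close>, the part of the
  window above \<open>x\<close> contributes \<open>1/a - 1/D\<close> with
  \<open>a = max x (1/D)\<close>. For \<open>x > D\<close> that part is empty and only the constant
  \<open>1/D\<close> remains.\<close>

lemma tapered_reciprocal_layer_cake:
  assumes "D \<ge> 1"
  shows "ennreal (tapered D (\<lambda>y. 1 / y) x) = ennreal (1 / D) +
    (\<integral>\<^sup>+t. ennreal (1 / t\<^sup>2) * indicator {inverse D..D} t * indicator {x..} t \<partial>lborel)"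
proof -
  define a where "a = max x (inverse D)"
  have D: "inverse D \<le> D" "0 < inverse D"
    using assms inverse_le_1_iff[of D] by auto
  then have "a > 0" by (simp add: a_def less_max_iff_disj del: inverse_positive_iff_positive)
  have "(\<integral>\<^sup>+t. ennreal (1 / t\<^sup>2) * indicator {inverse D..D} t * indicator {x..} t \<partial>lborel)
      = (\<integral>\<^sup>+t. ennreal (1 / t\<^sup>2) * indicator {a..D} t \<partial>lborel)"
    by (intro nn_integral_cong) (auto simp: a_def split: split_indicator)
  also have "ennreal (1 / D) + \<dots> = ennreal (tapered D (\<lambda>y. 1 / y) x)"
  proof (cases "a \<le> D")
    case True
    have "(\<integral>\<^sup>+t. ennreal (1 / t\<^sup>2) * indicator {a..D} t \<partial>lborel) = ennreal (- (1 / D) - - (1 / a))"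
    proof (rule nn_integral_FTC_Icc)
      fix t assume "t \<in> {a..D}"
      then have "t > 0" using \<open>a > 0\<close> by simp
      then show "((\<lambda>t. - (1 / t)) has_real_derivative 1 / t\<^sup>2) (at t)"
        by (auto intro!: derivative_eq_intros simp: power2_eq_square)
    qed (use True in auto)
    also have "ennreal (1 / D) + \<dots> = ennreal (1 / a)"
      using True \<open>a > 0\<close> by (subst ennreal_plus[symmetric]) (auto simp: frac_le)
    also have "1 / a = tapered D (\<lambda>y. 1 / y) x"
      using True by (auto simp: a_def tapered_def)
    finally show ?thesis .
  next
    case False
    then have "x > D" using D by (simp add: a_def max_def split: if_splits)
    moreover have "(\<integral>\<^sup>+t. ennreal (1 / t\<^sup>2) * indicator {a..D} t \<partial>lborel) = 0"
      using False by (auto simp: nn_integral_0_iff_AE)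
    ultimately show ?thesis
      using D by (auto simp: tapered_def)
  qed
  finally show ?thesis by simp
qed

lemma nn_integral_tapered_reciprocal:
  assumes "real_distribution Q" "D \<ge> 1"
  shows "(\<integral>\<^sup>+x. ennreal (tapered D (\<lambda>y. 1 / y) x) \<partial>Q) = ennreal (1 / D) +
    (\<integral>\<^sup>+t. ennreal (1 / t\<^sup>2) * indicator {inverse D..D} t * ennreal (cdf Q t) \<partial>lborel)"
proof -
  interpret real_distribution Q by fact
  interpret pair_sigma_finite Q lborel ..
  \<comment> \<open>Tonelli needs joint measurability in \<open>x\<close> and \<open>t\<close>; it
    is visible once the indicator is read as that of a closed half-plane.\<close>
  have ind: "indicator {x..} t = (indicator {z. fst z \<le> snd z} (x, t) :: ennreal)" for x t :: real
    by (auto split: split_indicator)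
  have [measurable]: "(\<lambda>(x, t). indicator {x..} t :: ennreal) \<in> borel_measurable (Q \<Otimes>\<^sub>M lborel)"
    unfolding ind by measurable
  have "(\<integral>\<^sup>+x. ennreal (tapered D (\<lambda>y. 1 / y) x) \<partial>Q) = ennreal (1 / D) +
    (\<integral>\<^sup>+x. \<integral>\<^sup>+t. ennreal (1 / t\<^sup>2) * indicator {inverse D..D} t * indicator {x..} t \<partial>lborel \<partial>Q)"
    using emeasure_space_1
    by (simp add: tapered_reciprocal_layer_cake[OF assms(2)] nn_integral_add)
  also have "(\<integral>\<^sup>+x. \<integral>\<^sup>+t. ennreal (1 / t\<^sup>2) * indicator {inverse D..D} t * indicator {x..} t \<partial>lborel \<partial>Q)
    = (\<integral>\<^sup>+t. \<integral>\<^sup>+x. ennreal (1 / t\<^sup>2) * indicator {inverse D..D} t * indicator {x..} t \<partial>Q \<partial>lborel)"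
    by (rule Fubini'[symmetric]) measurable
  also have "\<dots> = (\<integral>\<^sup>+t. ennreal (1 / t\<^sup>2) * indicator {inverse D..D} t * ennreal (cdf Q t) \<partial>lborel)"
  proof (rule nn_integral_cong)
    fix t :: real
    have "(\<integral>\<^sup>+x. indicator {x..} t \<partial>Q) = (\<integral>\<^sup>+x. indicator {..t} x \<partial>Q)"
      by (intro nn_integral_cong) (auto split: split_indicator)
    also have "\<dots> = ennreal (cdf Q t)"
      by (simp add: cdf_def emeasure_eq_measure)
    finally show "(\<integral>\<^sup>+x. ennreal (1 / t\<^sup>2) * indicator {inverse D..D} t * indicator {x..} t \<partial>Q)
      = ennreal (1 / t\<^sup>2) * indicator {inverse D..D} t * ennreal (cdf Q t)"
      by (subst nn_integral_cmult) (auto simp: ind)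
  qed
  finally show ?thesis .
qed

section \<open>Stability under the Wasserstein distance\<close>

lemma wasserstein_dist_commute: "wasserstein_dist Q1 Q2 = wasserstein_dist Q2 Q1"
  by (simp add: wasserstein_dist_def abs_minus_commute)

text \<open>The integrands over \<open>t\<close> are compared pointwise. The additive one-sided form
  avoids truncated subtraction and still makes sense when the distance is infinite.\<close>

lemma nn_integral_tapered_reciprocal_le:
  assumes Q1: "real_distribution Q1" and Q2: "real_distribution Q2" and "D \<ge> 1"
  shows "(\<integral>\<^sup>+x. ennreal (tapered D (\<lambda>y. 1 / y) x) \<partial>Q1)
    \<le> (\<integral>\<^sup>+x. ennreal (tapered D (\<lambda>y. 1 / y) x) \<partial>Q2) + ennreal (D\<^sup>2) * wasserstein_dist Q1 Q2"
proof -
  interpret Q1: real_distribution Q1 by fact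
  interpret Q2: real_distribution Q2 by fact
  let ?w = "\<lambda>t::real. ennreal (1 / t\<^sup>2) * indicator {inverse D..D} t"
  have [measurable]: "cdf Q1 \<in> borel_measurable borel" "cdf Q2 \<in> borel_measurable borel"
    by (auto intro!: borel_measurable_mono monoI Q1.cdf_nondecreasing Q2.cdf_nondecreasing)
  have pos: "0 < inverse D" using assms by simp
  \<comment> \<open>The indicator of \<open>{0..}\<close> copies the integration range of
    \<open>wasserstein_dist\<close>; it equals 1 on the window, the only place where the weight is
    nonzero.\<close>
  have "?w t * ennreal (cdf Q1 t) \<le> ?w t * ennreal (cdf Q2 t)
      + ennreal (D\<^sup>2) * (ennreal \<bar>cdf Q1 t - cdf Q2 t\<bar> * indicator {0..} t)" for t
  proof (cases "t \<in> {inverse D..D}")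
    case True
    then have t: "inverse D \<le> t" by simp
    with pos have "t > 0" by (rule less_le_trans)
    have "1 / t \<le> D"
      using le_imp_inverse_le[OF t pos] by (simp add: inverse_eq_divide)
    then have "(1 / t)\<^sup>2 \<le> D\<^sup>2" using \<open>t > 0\<close> by (intro power_mono) auto
    then have w: "1 / t\<^sup>2 \<le> D\<^sup>2" by (simp add: power_one_over)
    have "1 / t\<^sup>2 * cdf Q1 t \<le> 1 / t\<^sup>2 * (cdf Q2 t + \<bar>cdf Q1 t - cdf Q2 t\<bar>)"
      by (intro mult_left_mono) auto
    also have "\<dots> \<le> 1 / t\<^sup>2 * cdf Q2 t + D\<^sup>2 * \<bar>cdf Q1 t - cdf Q2 t\<bar>"
      using mult_right_mono[OF w, of "\<bar>cdf Q1 t - cdf Q2 t\<bar>"] by (simp add: distrib_left)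
    finally have "ennreal (1 / t\<^sup>2 * cdf Q1 t)
        \<le> ennreal (1 / t\<^sup>2 * cdf Q2 t + D\<^sup>2 * \<bar>cdf Q1 t - cdf Q2 t\<bar>)"
      by (rule ennreal_leI)
    then show ?thesis
      using True \<open>t > 0\<close>
      by (simp add: ennreal_mult Q1.cdf_nonneg Q2.cdf_nonneg del: times_divide_eq_left)
  qed simp
  then have "(\<integral>\<^sup>+t. ?w t * ennreal (cdf Q1 t) \<partial>lborel) \<le> (\<integral>\<^sup>+t. ?w t * ennreal (cdf Q2 t)
      + ennreal (D\<^sup>2) * (ennreal \<bar>cdf Q1 t - cdf Q2 t\<bar> * indicator {0..} t) \<partial>lborel)"
    by (intro nn_integral_mono)
  also have "\<dots> = (\<integral>\<^sup>+t. ?w t * ennreal (cdf Q2 t) \<partial>lborel) + ennreal (D\<^sup>2) * wasserstein_dist Q1 Q2"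
    unfolding wasserstein_dist_def
    by (subst nn_integral_add) (auto simp: nn_integral_cmult)
  finally show ?thesis
    using assms by (simp add: nn_integral_tapered_reciprocal add.assoc add_left_mono)
qed

lemma integral_tapered_reciprocal_diff_le:
  assumes Q1: "real_distribution Q1" and Q2: "real_distribution Q2" and D: "D \<ge> 1"
  shows "ennreal \<bar>(LINT x|Q1. tapered D (\<lambda>y. 1 / y) x) - (LINT x|Q2. tapered D (\<lambda>y. 1 / y) x)\<bar>
    \<le> ennreal (D\<^sup>2) * wasserstein_dist Q1 Q2"
proof -
  let ?I = "\<lambda>Q. LINT x|Q. tapered D (\<lambda>y. 1 / y) x"
  have nonneg: "?I Q \<ge> 0" for Q :: "real measure"
    using tapered_reciprocal_bounds(1)[OF D] by (intro integral_nonneg_AE) auto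
  have nn: "(\<integral>\<^sup>+x. ennreal (tapered D (\<lambda>y. 1 / y) x) \<partial>Q) = ennreal (?I Q)"
    if "real_distribution Q" for Q
    using integrable_tapered_reciprocal[OF that D] tapered_reciprocal_bounds(1)[OF D]
    by (intro nn_integral_eq_integral) auto
  \<comment> \<open>\<open>ennreal\<close> sends a negative difference to 0, so this direction alone
    bounds only the positive part; swapping the two distributions gives the absolute value.\<close>
  have one_sided: "ennreal (?I Q - ?I Q') \<le> ennreal (D\<^sup>2) * wasserstein_dist Q Q'"
    if "real_distribution Q" "real_distribution Q'" for Q Q'
    using nn_integral_tapered_reciprocal_le[OF that D] nonneg[of Q] nonneg[of Q']
    by (simp add: nn that ennreal_minus[symmetric] ennreal_minus_le_iff)
  show ?thesis
    using one_sided[OF Q1 Q2] one_sided[OF Q2 Q1]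
    by (auto simp: abs_if wasserstein_dist_commute[of Q2 Q1])
qed

text \<open>Links the estimator, an integral over \<open>{0..}\<close>, to the stability bound,
  which concerns integrals over the whole line.\<close>

lemma set_lebesgue_integral_eq_integral_nonneg_distribution:
  assumes "nonneg_distribution Q" and "f \<in> borel_measurable borel"
  shows "(LINT x:{0..}|Q. f x) = (LINT x|Q. f x :: real)"
proof -
  interpret real_distribution Q
    using assms by (simp add: nonneg_distribution_def)
  have "AE x in Q. x \<in> {0..}"
    using assms by (intro AE_prob_1) (simp add: nonneg_distribution_def)
  then show ?thesis
    using assms(2) unfolding set_lebesgue_integral_def
    by (intro integral_cong_AE) auto
qed

section \<open>Rare-events sources: support of the limit and alphabet size\<close>

context
  fixes A :: "nat \<Rightarrow> 'a set" and p :: "nat \<Rightarrow> 'a pmf"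
    and c1 c2 :: real and P :: "real measure"
  assumes source: "rare_events_source A p c1 c2 P"
begin

lemma rare_events_source_real_distribution: "real_distribution P"
  using source by (simp add: rare_events_source_def)

text \<open>The lower bound \<open>c1 / n > 0\<close> gives every letter positive mass, so a sum
  over the support counts the whole alphabet.\<close>

lemma rare_events_source_set_pmf:
  assumes "n \<ge> 1"
  shows "set_pmf (p n) = A n"
proof -
  have "pmf (p n) a > 0" if "a \<in> A n" for a
  proof -
    have "0 < c1 / real n" "c1 / real n \<le> pmf (p n) a"
      using source assms that by (auto simp: rare_events_source_def)
    then show ?thesis by linarith
  qed
  then show ?thesis
    using source assms by (force simp: rare_events_source_def set_pmf_iff)
qed

lemma rare_events_source_expectation:
  fixes f :: "real \<Rightarrow> real"
  assumes "n \<ge> 1" "f \<in> borel_measurable borel"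
  shows "(LINT x|scaled_prob_distr n (p n). f x)
    = (\<Sum>a\<in>A n. pmf (p n) a * f (real n * pmf (p n) a))"
proof -
  have "finite (A n)" using source assms(1) by (simp add: rare_events_source_def)
  then have "(LINT a|p n. f (real n * pmf (p n) a))
      = (\<Sum>a\<in>A n. pmf (p n) a *\<^sub>R f (real n * pmf (p n) a))"
    by (rule integral_measure_pmf) (simp add: rare_events_source_set_pmf[OF assms(1)])
  then show ?thesis
    using assms(2) by (simp add: scaled_prob_distr_def integral_distr)
qed

lemma rare_events_source_scaled_bounds:
  assumes "n \<ge> 1" "a \<in> A n"
  shows "c1 \<le> real n * pmf (p n) a" "real n * pmf (p n) a \<le> c2"
proof -
  have "c1 / real n \<le> pmf (p n) a" "pmf (p n) a \<le> c2 / real n"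
    using source assms by (auto simp: rare_events_source_def)
  then show "c1 \<le> real n * pmf (p n) a" "real n * pmf (p n) a \<le> c2"
    using assms(1) by (auto simp: field_simps)
qed

lemma rare_events_source_expectation_tendsto:
  fixes f :: "real \<Rightarrow> real"
  assumes "continuous_on UNIV f" "\<And>x. \<bar>f x\<bar> \<le> B"
  shows "(\<lambda>n. LINT x|scaled_prob_distr n (p n). f x) \<longlonglongrightarrow> (LINT x|P. f x)"
proof (rule weak_conv_imp_integral_bdd_continuous_conv)
  show "real_distribution (scaled_prob_distr n (p n))" for n
    unfolding scaled_prob_distr_def
    by (intro prob_space.real_distribution_distr) (auto intro: prob_space_measure_pmf)
  show "isCont f x" for x
    using assms(1) by (simp add: continuous_on_eq_continuous_at)
qed (use source assms(2) in \<open>auto simp: rare_events_source_def\<close>)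

text \<open>Tested on the truncated distance to \<open>[c1, c2]\<close>, which vanishes under every \<open>P\<^sub>n\<close>.\<close>

lemma rare_events_source_support: "AE x in P. x \<in> {c1..c2}"
proof -
  interpret real_distribution P by (rule rare_events_source_real_distribution)
  define f where "f = (\<lambda>x::real. min 1 (max 0 (max (c1 - x) (x - c2))))"
  have cont: "continuous_on UNIV f" unfolding f_def by (intro continuous_intros)
  have bdd: "\<bar>f x\<bar> \<le> 1" for x by (simp add: f_def)
  have [measurable]: "f \<in> borel_measurable borel"
    using cont by (rule borel_measurable_continuous_onI)
  have "(LINT x|scaled_prob_distr n (p n). f x) = 0" if "n \<ge> 1" for n
  proof -
    have "f (real n * pmf (p n) a) = 0" if "a \<in> A n" for a
      using rare_events_source_scaled_bounds[OF \<open>n \<ge> 1\<close> that] by (simp add: f_def)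
    then show ?thesis
      using that by (simp add: rare_events_source_expectation)
  qed
  \<comment> \<open>The entry at index 0 is unconstrained, hence only an eventual equality.\<close>
  then have "\<forall>\<^sub>F n in sequentially. (LINT x|scaled_prob_distr n (p n). f x) = 0"
    by (auto simp: eventually_sequentially)
  then have "(\<lambda>n. LINT x|scaled_prob_distr n (p n). f x) \<longlonglongrightarrow> 0"
    by (rule tendsto_eventually)
  then have "(LINT x|P. f x) = 0"
    using rare_events_source_expectation_tendsto[OF cont bdd] LIMSEQ_unique by blast
  moreover have "integrable P f"
    using bdd by (intro integrable_const_bound[where B = 1]) auto
  \<comment> \<open>A nonnegative function with zero integral vanishes almost everywhere, and
    \<open>f\<close> vanishes only on \<open>[c1, c2]\<close>.\<close>
  ultimately have "AE x in P. f x = 0"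
    by (subst (asm) integral_nonneg_eq_0_iff_AE) (auto simp: f_def)
  moreover have "x \<in> {c1..c2}" if "f x = 0" for x
    using that unfolding f_def by (cases "x < c1"; cases "c2 < x") simp_all
  ultimately show ?thesis
    by (rule eventually_mono)
qed

text \<open>Because \<open>P\<close> charges only \<open>[c1, c2]\<close>, values elsewhere do not
  matter. This serves two extensions of \<open>1/x\<close>: the one cut off at \<open>c1\<close> and
  the tapered one.\<close>

lemma rare_events_source_integral_eq:
  fixes f :: "real \<Rightarrow> real"
  assumes "f \<in> borel_measurable borel" "\<And>x. x \<in> {c1..c2} \<Longrightarrow> f x = 1 / x"
  shows "(LINT x|P. f x) = (LINT x:{c1..c2}|P. 1 / x)"
proof -
  interpret real_distribution P by (rule rare_events_source_real_distribution)
  show ?thesis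
    unfolding set_lebesgue_integral_def
  proof (rule integral_cong_AE)
    show "AE x in P. f x = indicat_real {c1..c2} x *\<^sub>R (1 / x)"
      using rare_events_source_support by eventually_elim (simp add: assms(2))
  qed (use assms(1) in auto)
qed

text \<open>A letter of mass \<open>q\<close> contributes \<open>q * 1/(n*q) = 1/n\<close> to the
  expectation of the reciprocal, whatever \<open>q\<close> is.\<close>

lemma normalized_alphabet_size_tendsto:
  "normalized_alphabet_size A \<longlonglongrightarrow> (LINT x:{c1..c2}|P. 1 / x)"
proof -
  have c1: "c1 > 0" using source by (simp add: rare_events_source_def)
  \<comment> \<open>The cut-off at \<open>c1\<close> makes the reciprocal bounded and continuous on
    the whole line without changing it on \<open>[c1, c2]\<close>.\<close>
  define f where "f = (\<lambda>x::real. 1 / max c1 x)"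
  have cont: "continuous_on UNIV f"
    using c1 unfolding f_def by (intro continuous_intros) (auto simp: max_def)
  have bdd: "\<bar>f x\<bar> \<le> 1 / c1" for x
    using c1 by (simp add: f_def frac_le)
  have meas: "f \<in> borel_measurable borel"
    using cont by (rule borel_measurable_continuous_onI)
  have size_eq: "(LINT x|scaled_prob_distr n (p n). f x) = normalized_alphabet_size A n"
    if n: "n \<ge> 1" for n
  proof -
    have "pmf (p n) a * f (real n * pmf (p n) a) = 1 / real n" if "a \<in> A n" for a
    proof -
      have "pmf (p n) a \<noteq> 0"
        using that rare_events_source_set_pmf[OF n] by (auto simp: set_pmf_iff)
      then show ?thesis
        using rare_events_source_scaled_bounds(1)[OF n that] by (simp add: f_def max_def)
    qed
    then show ?thesis
      using n meas by (simp add: rare_events_source_expectation normalized_alphabet_size_def)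
  qed
  have "(\<lambda>n. LINT x|scaled_prob_distr n (p n). f x) \<longlonglongrightarrow> (LINT x:{c1..c2}|P. 1 / x)"
    using rare_events_source_expectation_tendsto[OF cont bdd]
      rare_events_source_integral_eq[OF meas]
    by (simp add: f_def max_def)
  moreover have "\<forall>\<^sub>F n in sequentially.
      (LINT x|scaled_prob_distr n (p n). f x) = normalized_alphabet_size A n"
    using size_eq by (auto simp: eventually_sequentially)
  ultimately show ?thesis
    by (rule Lim_transform_eventually)
qed

section \<open>Consistency of the estimator\<close>

text \<open>Deterministic core, to be applied to a single outcome: the error is squeezed between 0
  and the rescaled distance.\<close>

lemma alphabet_size_estimator_tendsto:
  assumes "s > 0"
    and Q: "\<And>n. n \<ge> 1 \<Longrightarrow> nonneg_distribution (Q n)"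
    and lim: "(\<lambda>n. ennreal (real n powr s) * wasserstein_dist (Q n) P) \<longlonglongrightarrow> 0"
  shows "(\<lambda>n. alphabet_size_estimator s n (Q n)) \<longlonglongrightarrow> (LINT x:{c1..c2}|P. 1 / x)"
proof -
  let ?L = "LINT x:{c1..c2}|P. 1 / x"
  define D where "D = (\<lambda>n. real n powr (s / 2))"
  have "filterlim D at_top sequentially"
    unfolding D_def using \<open>s > 0\<close> by real_asymp
  then have D_ge: "\<forall>\<^sub>F n in sequentially. b \<le> D n" for b
    by (simp add: filterlim_at_top)
  have "\<forall>\<^sub>F n in sequentially. ennreal \<bar>alphabet_size_estimator s n (Q n) - ?L\<bar>
      \<le> ennreal (real n powr s) * wasserstein_dist (Q n) P"
    \<comment> \<open>\<open>n \<ge> 1\<close> yields \<open>D n \<ge> 1\<close>; the other two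
      conditions put \<open>[c1, c2]\<close> inside the window, where tapering changes
      nothing.\<close>
    using eventually_ge_at_top[of "1::nat"]
      D_ge[of "1 / c1"] D_ge[of c2]
  proof eventually_elim
    case (elim n)
    have "D n \<ge> 1"
      using elim(1) \<open>s > 0\<close> by (simp add: D_def ge_one_powr_ge_zero)
    have "c1 > 0" using source by (simp add: rare_events_source_def)
    then have "inverse (D n) \<le> c1"
      using le_imp_inverse_le[OF elim(2)] by simp
    then have "(LINT x|P. tapered (D n) (\<lambda>y. 1 / y) x) = ?L"
      using elim by (intro rare_events_source_integral_eq) (auto simp: tapered_def)
    moreover have "(D n)\<^sup>2 = real n powr s"
      using elim(1) by (simp add: D_def power2_eq_square powr_add[symmetric])
    moreover have "alphabet_size_estimator s n (Q n) = (LINT x|Q n. tapered (D n) (\<lambda>y. 1 / y) x)"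
      unfolding alphabet_size_estimator_def D_def
      by (intro set_lebesgue_integral_eq_integral_nonneg_distribution Q elim)
         (rule borel_measurable_tapered_reciprocal)
    ultimately show ?case
      using integral_tapered_reciprocal_diff_le[OF _ rare_events_source_real_distribution
          \<open>D n \<ge> 1\<close>, of "Q n"] Q[OF elim(1)]
      unfolding nonneg_distribution_def by metis
  qed
  then have "(\<lambda>n. ennreal \<bar>alphabet_size_estimator s n (Q n) - ?L\<bar>) \<longlonglongrightarrow> 0"
    by (intro tendsto_sandwich[OF _ _ tendsto_const lim]) auto
  then have "(\<lambda>n. \<bar>alphabet_size_estimator s n (Q n) - ?L\<bar>) \<longlonglongrightarrow> 0"
    unfolding ennreal_0[symmetric] by (subst (asm) tendsto_ennreal_iff) auto
  then show ?thesis
    by (rule LIM_zero_cancel[OF tendsto_rabs_zero_cancel])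
qed

text \<open>Each sample has law \<open>p n\<close>, supported on \<open>A n\<close>; the exceptional
  null sets are countably many.\<close>

lemma AE_samples_in_alphabet:
  assumes "iid_samples M p X"
  shows "AE w in M. \<forall>n\<ge>1. \<forall>i\<in>{1..n}. X n i w \<in> A n"
proof -
  interpret prob_space M using assms by (simp add: iid_samples_def)
  have "AE w in M. X n i w \<in> A n" if "n \<ge> 1" "i \<in> {1..n}" for n i
  proof -
    have meas: "X n i \<in> measurable M (count_space UNIV)"
      and distr: "distr M (count_space UNIV) (X n i) = measure_pmf (p n)"
      using assms that by (auto simp: iid_samples_def indep_vars_def)
    have "AE a in distr M (count_space UNIV) (X n i). a \<in> A n"
      unfolding distr by (simp add: AE_measure_pmf_iff rare_events_source_set_pmf[OF that(1)])
    then show ?thesis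
      using meas by (simp add: AE_distr_iff)
  qed
  then show ?thesis
    by (intro AE_all_countable[THEN iffD2] allI AE_impI AE_finite_allI) auto
qed

end

theorem mainTheorem6:
  fixes A :: "nat \<Rightarrow> 'a set" and p :: "nat \<Rightarrow> 'a pmf"
    and c1 c2 :: real and P :: "real measure"
    and M :: "'w measure" and X :: "nat \<Rightarrow> nat \<Rightarrow> 'w \<Rightarrow> 'a"
    and Pt :: "nat \<Rightarrow> 'w \<Rightarrow> real measure" and s :: real
  assumes "rare_events_source A p c1 c2 P"
    and "iid_samples M p X"
    and "constructed_from_samples M A X Pt"
    and "s > 0"
    and "AE w in M. (\<lambda>n. ennreal (real n powr s) * wasserstein_dist (Pt n w) P) \<longlonglongrightarrow> 0"
  shows "(AE w in M. (\<lambda>n. alphabet_size_estimator s n (Pt n w))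
              \<longlonglongrightarrow> (LINT x:{c1..c2}|P. 1 / x))
       \<and> normalized_alphabet_size A \<longlonglongrightarrow> (LINT x:{c1..c2}|P. 1 / x)"
proof
  obtain K :: "nat \<Rightarrow> (nat \<Rightarrow> 'a) \<Rightarrow> real measure"
    where K: "\<And>n x. n \<ge> 1 \<Longrightarrow> x \<in> {1..n} \<rightarrow>\<^sub>E A n \<Longrightarrow> nonneg_distribution (K n x)"
      and Pt: "\<And>n w. n \<ge> 1 \<Longrightarrow> w \<in> space M \<Longrightarrow> Pt n w = K n (\<lambda>i\<in>{1..n}. X n i w)"
    using assms(3) unfolding constructed_from_samples_def by blast
  show "AE w in M. (\<lambda>n. alphabet_size_estimator s n (Pt n w)) \<longlonglongrightarrow> (LINT x:{c1..c2}|P. 1 / x)"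
    using AE_samples_in_alphabet[OF assms(1,2)] assms(5) AE_space
  proof eventually_elim
    case (elim w)
    \<comment> \<open>The rule \<open>K n\<close> is controlled only on tuples over the alphabet,
      hence the restriction to outcomes whose samples all stay in it.\<close>
    have "nonneg_distribution (Pt n w)" if "n \<ge> 1" for n
      unfolding Pt[OF that elim(3)] using elim(1) that by (intro K) auto
    then show ?case
      by (rule alphabet_size_estimator_tendsto[OF assms(1,4) _ elim(2)])
  qed
  show "normalized_alphabet_size A \<longlonglongrightarrow> (LINT x:{c1..c2}|P. 1 / x)"
    by (rule normalized_alphabet_size_tendsto[OF assms(1)])
qed

end
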